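(* There is a lattice-embedding from $H_\omega$ into $H_2$.
   Context: $H_2$ is the free Heyting algebra on two generators (propositional formulas in the variables $x_1,x_2$ modulo intuitionistic logical equivalence), and $H_\omega$ is the free Heyting algebra on countably infinitely many generators (propositional formulas in the variables $x_1,x_2,\ldots$ modulo intuitionistic logical equivalence). A lattice-embedding is an injective map preserving $\wedge$ and $\vee$; it is not required to preserve $\top$, $\bot$ or $\rightarrow$. *)

theory Defs
  imports Main "HOL-Library.Numeral_Type"
begin

datatype 'v form =
    Var 'v
  | Bot
  | And "'v form" "'v form"
  | Or "'v form" "'v form"
  | Imp "'v form" "'v form"

text \<open>
  Negation and truth are the usual abbreviations \<open>Imp p Bot\<close> and \<open>Imp Bot Bot\<close>.
  Omitting double negation elimination is what makes the following natural deduction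
  calculus intuitionistic.
\<close>

inductive deriv :: "'v form set \<Rightarrow> 'v form \<Rightarrow> bool"  (infix "\<turnstile>" 50) where
  Assm:  "p \<in> \<Gamma> \<Longrightarrow> \<Gamma> \<turnstile> p"
| BotE:  "\<Gamma> \<turnstile> Bot \<Longrightarrow> \<Gamma> \<turnstile> p"
| AndI:  "\<Gamma> \<turnstile> p \<Longrightarrow> \<Gamma> \<turnstile> q \<Longrightarrow> \<Gamma> \<turnstile> And p q"
| AndE1: "\<Gamma> \<turnstile> And p q \<Longrightarrow> \<Gamma> \<turnstile> p"
| AndE2: "\<Gamma> \<turnstile> And p q \<Longrightarrow> \<Gamma> \<turnstile> q"
| OrI1:  "\<Gamma> \<turnstile> p \<Longrightarrow> \<Gamma> \<turnstile> Or p q"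
| OrI2:  "\<Gamma> \<turnstile> q \<Longrightarrow> \<Gamma> \<turnstile> Or p q"
| OrE:   "\<Gamma> \<turnstile> Or p q \<Longrightarrow> insert p \<Gamma> \<turnstile> r \<Longrightarrow> insert q \<Gamma> \<turnstile> r \<Longrightarrow> \<Gamma> \<turnstile> r"
| ImpI:  "insert p \<Gamma> \<turnstile> q \<Longrightarrow> \<Gamma> \<turnstile> Imp p q"
| ImpE:  "\<Gamma> \<turnstile> Imp p q \<Longrightarrow> \<Gamma> \<turnstile> p \<Longrightarrow> \<Gamma> \<turnstile> q"

definition int_equiv :: "'v form \<Rightarrow> 'v form \<Rightarrow> bool" where
  "int_equiv p q \<longleftrightarrow> {} \<turnstile> And (Imp p q) (Imp q p)"

lemma deriv_weaken: "\<Gamma> \<turnstile> p \<Longrightarrow> \<Gamma> \<subseteq> \<Delta> \<Longrightarrow> \<Delta> \<turnstile> p"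
proof (induction arbitrary: \<Delta> rule: deriv.induct)
  case (OrE \<Gamma> p q r)
  from OrE.prems have "insert p \<Gamma> \<subseteq> insert p \<Delta>" "insert q \<Gamma> \<subseteq> insert q \<Delta>" by auto
  with OrE show ?case by (meson deriv.OrE)
next
  case (ImpI p \<Gamma> q)
  from ImpI.prems have "insert p \<Gamma> \<subseteq> insert p \<Delta>" by auto
  with ImpI show ?case by (meson deriv.ImpI)
qed (auto intro: deriv.intros)

lemma deriv_Imp_iff: "\<Gamma> \<turnstile> Imp p q \<longleftrightarrow> insert p \<Gamma> \<turnstile> q"
proof
  assume "\<Gamma> \<turnstile> Imp p q"
  then have "insert p \<Gamma> \<turnstile> Imp p q" by (rule deriv_weaken) auto
  then show "insert p \<Gamma> \<turnstile> q" by (rule ImpE) (simp add: Assm)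
qed (rule ImpI)

lemma deriv_cut: "\<Gamma> \<turnstile> p \<Longrightarrow> insert p \<Gamma> \<turnstile> q \<Longrightarrow> \<Gamma> \<turnstile> q"
  using ImpE ImpI by blast

lemma deriv_trans: "{p} \<turnstile> q \<Longrightarrow> {q} \<turnstile> r \<Longrightarrow> {p} \<turnstile> r"
  by (rule deriv_cut[of "{p}" q]) (auto elim: deriv_weaken)

lemma int_equiv_iff: "int_equiv p q \<longleftrightarrow> {p} \<turnstile> q \<and> {q} \<turnstile> p"
  unfolding int_equiv_def by (metis AndI AndE1 AndE2 deriv_Imp_iff)

lemma deriv_And_iff: "\<Gamma> \<turnstile> And p q \<longleftrightarrow> \<Gamma> \<turnstile> p \<and> \<Gamma> \<turnstile> q"
  by (meson AndI AndE1 AndE2)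

lemma deriv_And_left: "{p} \<turnstile> r \<or> {q} \<turnstile> r \<Longrightarrow> {And p q} \<turnstile> r"
  by (meson AndE1 AndE2 Assm deriv_trans singletonI)

lemma deriv_Or_right: "{r} \<turnstile> p \<or> {r} \<turnstile> q \<Longrightarrow> {r} \<turnstile> Or p q"
  by (meson OrI1 OrI2)

lemma deriv_Or_left: "{p} \<turnstile> r \<Longrightarrow> {q} \<turnstile> r \<Longrightarrow> {Or p q} \<turnstile> r"
  by (rule OrE[of _ p q]) (auto intro: Assm elim: deriv_weaken)

lemma deriv_residuation: "{r} \<turnstile> Imp p q \<longleftrightarrow> {And r p} \<turnstile> q"
proof
  assume "{r} \<turnstile> Imp p q"
  then have "{And r p} \<turnstile> Imp p q" by (meson AndE1 Assm deriv_trans singletonI)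
  moreover have "{And r p} \<turnstile> p" by (meson AndE2 Assm singletonI)
  ultimately show "{And r p} \<turnstile> q" by (rule ImpE)
next
  assume "{And r p} \<turnstile> q"
  then have "insert (And r p) {p, r} \<turnstile> q" by (rule deriv_weaken) auto
  moreover have "{p, r} \<turnstile> And r p" by (auto intro: AndI Assm)
  ultimately have "{p, r} \<turnstile> q" using deriv_cut by blast
  then show "{r} \<turnstile> Imp p q" by (simp add: deriv_Imp_iff)
qed

text \<open>The free Heyting algebra on the set of all elements of \<open>'v\<close>.\<close>

quotient_type 'v free_heyting = "'v form" / int_equiv
proof (rule equivpI)
  show "reflp (int_equiv :: 'v form \<Rightarrow> _)"
    by (auto simp: reflp_def int_equiv_iff intro: Assm)
  show "symp (int_equiv :: 'v form \<Rightarrow> _)"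
    by (auto simp: symp_def int_equiv_iff)
  show "transp (int_equiv :: 'v form \<Rightarrow> _)"
    unfolding transp_def int_equiv_iff by (meson deriv_trans)
qed

class heyting_algebra = bounded_lattice +
  fixes himp :: "'a \<Rightarrow> 'a \<Rightarrow> 'a"
  assumes himp_residuation: "z \<le> himp x y \<longleftrightarrow> inf z x \<le> y"

instantiation free_heyting :: (type) heyting_algebra
begin

lift_definition less_eq_free_heyting :: "'a free_heyting \<Rightarrow> 'a free_heyting \<Rightarrow> bool"
  is "\<lambda>p q. {} \<turnstile> Imp p q"
  unfolding int_equiv_iff deriv_Imp_iff by (meson deriv_trans)

definition less_free_heyting :: "'a free_heyting \<Rightarrow> 'a free_heyting \<Rightarrow> bool" where
  "less_free_heyting x y \<longleftrightarrow> x \<le> y \<and> \<not> y \<le> x"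

lift_definition inf_free_heyting :: "'a free_heyting \<Rightarrow> 'a free_heyting \<Rightarrow> 'a free_heyting"
  is And
  unfolding int_equiv_iff by (simp add: deriv_And_iff deriv_And_left)

lift_definition sup_free_heyting :: "'a free_heyting \<Rightarrow> 'a free_heyting \<Rightarrow> 'a free_heyting"
  is Or
  unfolding int_equiv_iff by (simp add: deriv_Or_left deriv_Or_right)

lift_definition bot_free_heyting :: "'a free_heyting" is Bot .

lift_definition top_free_heyting :: "'a free_heyting" is "Imp Bot Bot" .

lift_definition himp_free_heyting :: "'a free_heyting \<Rightarrow> 'a free_heyting \<Rightarrow> 'a free_heyting"
  is Imp
proof -
  have "{Imp p r} \<turnstile> Imp q s" if "{q} \<turnstile> p" "{r} \<turnstile> s" for p q r s :: "'a form"
  proof -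
    have "{And (Imp p r) q} \<turnstile> p" using that by (simp add: deriv_And_left)
    moreover have "{And (Imp p r) q} \<turnstile> Imp p r" by (simp add: deriv_And_left Assm)
    ultimately have "{And (Imp p r) q} \<turnstile> r" using ImpE by blast
    with that show ?thesis unfolding deriv_residuation by (meson deriv_trans)
  qed
  then show "int_equiv p1 p2 \<Longrightarrow> int_equiv q1 q2 \<Longrightarrow> int_equiv (Imp p1 q1) (Imp p2 q2)"
    for p1 p2 q1 q2 :: "'a form"
    unfolding int_equiv_iff by blast
qed

instance
proof
  fix x y z :: "'a free_heyting"
  show "x < y \<longleftrightarrow> x \<le> y \<and> \<not> y \<le> x" by (rule less_free_heyting_def)
  show "x \<le> x" by transfer (simp add: deriv_Imp_iff Assm)
  show "x \<le> y \<Longrightarrow> y \<le> z \<Longrightarrow> x \<le> z"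
    by transfer (unfold deriv_Imp_iff, rule deriv_trans)
  show "x \<le> y \<Longrightarrow> y \<le> x \<Longrightarrow> x = y" by transfer (simp add: deriv_Imp_iff int_equiv_iff)
  show "inf x y \<le> x" by transfer (simp add: deriv_Imp_iff deriv_And_left Assm)
  show "inf x y \<le> y" by transfer (simp add: deriv_Imp_iff deriv_And_left Assm)
  show "x \<le> y \<Longrightarrow> x \<le> z \<Longrightarrow> x \<le> inf y z"
    by transfer (simp add: deriv_Imp_iff deriv_And_iff)
  show "x \<le> sup x y" by transfer (simp add: deriv_Imp_iff deriv_Or_right Assm)
  show "y \<le> sup x y" by transfer (simp add: deriv_Imp_iff deriv_Or_right Assm)
  show "y \<le> x \<Longrightarrow> z \<le> x \<Longrightarrow> sup y z \<le> x"
    by transfer (simp add: deriv_Imp_iff deriv_Or_left)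
  show "bot \<le> x" by transfer (simp add: deriv_Imp_iff BotE Assm)
  show "x \<le> top" by transfer (simp add: deriv_Imp_iff Assm)
  show "z \<le> himp x y \<longleftrightarrow> inf z x \<le> y"
    by transfer (metis deriv_Imp_iff deriv_residuation)
qed

end

definition lattice_embedding :: "('a::lattice \<Rightarrow> 'b::lattice) \<Rightarrow> bool" where
  "lattice_embedding f \<longleftrightarrow>
     inj f \<and> (\<forall>x y. f (inf x y) = inf (f x) (f y)) \<and> (\<forall>x y. f (sup x y) = sup (f x) (f y))"

text \<open>
  Here \<open>2\<close> is the two-element numeral type; its elements are \<open>1\<close> and \<open>2 = 0\<close>.
\<close>

type_synonym H_2 = "2 free_heyting"
type_synonym H_omega = "nat free_heyting"

end

theory Submission
  imports Defs
begin

text \<open>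
  For every element \<open>d\<close> of a Heyting algebra, the elements above \<open>d\<close> form a Heyting algebra with
  the same meets, joins and implications, and with \<open>d\<close> as least element. So any choice of images
  above \<open>d\<close> for the generators extends to a map from formulas that preserves \<open>And\<close>, \<open>Or\<close> and
  \<open>Imp\<close>, sends \<open>Bot\<close> to \<open>d\<close>, and respects derivability: this is the translation \<open>translate\<close>. The
  freedom to choose \<open>d\<close> is what makes two variables suffice. With \<open>d\<close> the bottom element a
  Heyting embedding is impossible, since \<open>H_2\<close> has only finitely many regular elements; above
  \<open>d = \<not>y \<or> \<not>\<not>y\<close> there is enough room for infinitely many independent generators.

  Injectivity is shown by turning a countermodel over infinitely many variables into one over \<open>x\<close>
  and \<open>y\<close>. The countermodel is the canonical one, whose points are the prime theories \<open>T\<close>. Further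
  points, the gadget, are put above these. They all force \<open>d\<close>, while no prime theory does.
  Translated formulas are then true throughout the gadget, so that only prime theories matter for
  their evaluation, and a translated formula is forced at \<open>T\<close> exactly if the original one lies
  in \<open>T\<close> (\<open>forces_translate_iff\<close>), provided that this is so for the generators
  (\<open>Prime_forces_gen\<close>). The lemma \<open>translate_deriv_iff\<close> follows: the translation reflects
  derivability.

  To get the generators right, the gadget contains the Rieger-Nishimura ladder in the variable \<open>x\<close>, with
  \<open>y\<close> true on all rungs, and below each rung \<open>i + 1\<close> a foot \<open>i\<close> where \<open>y\<close> fails. One-variable
  formulas tell the rungs apart, and hence the feet; the variable \<open>y\<close> makes the feet
  incomparable to each other, so that a prime theory may see an arbitrary set of feet. It
  is made to see foot \<open>i\<close> exactly if it does not contain the variable \<open>i\<close>, and the \<open>i\<close>-th generator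
  is sent to a formula saying that foot \<open>i\<close> is not seen.
\<close>

section \<open>Prime theories\<close>

definition prime_theory :: "'v form set \<Rightarrow> bool" where
  "prime_theory T \<longleftrightarrow>
     (\<forall>p. T \<turnstile> p \<longrightarrow> p \<in> T) \<and> Bot \<notin> T \<and> (\<forall>p q. Or p q \<in> T \<longrightarrow> p \<in> T \<or> q \<in> T)"

lemma deriv_finite_subset:
  assumes "\<Gamma> \<turnstile> p"
  shows "\<exists>F. finite F \<and> F \<subseteq> \<Gamma> \<and> F \<turnstile> p"
  using assms
proof (induction rule: deriv.induct)
  case (Assm p \<Gamma>)
  then show ?case by (intro exI[of _ "{p}"]) (auto intro: deriv.Assm)
next
  case (BotE \<Gamma> p)
  then show ?case by (meson deriv.BotE)
next
  case (AndI \<Gamma> p q)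
  then obtain F G where "finite F" "F \<subseteq> \<Gamma>" "F \<turnstile> p" "finite G" "G \<subseteq> \<Gamma>" "G \<turnstile> q" by blast
  then have "F \<union> G \<turnstile> And p q" "finite (F \<union> G)" "F \<union> G \<subseteq> \<Gamma>"
    by (auto simp: deriv_And_iff elim: deriv_weaken)
  then show ?case by blast
next
  case (AndE1 \<Gamma> p q)
  then show ?case by (meson deriv.AndE1)
next
  case (AndE2 \<Gamma> p q)
  then show ?case by (meson deriv.AndE2)
next
  case (OrI1 \<Gamma> p q)
  then show ?case by (meson deriv.OrI1)
next
  case (OrI2 \<Gamma> q p)
  then show ?case by (meson deriv.OrI2)
next
  case (OrE \<Gamma> p q r)
  then obtain F G H where fin: "finite F" "finite G" "finite H"
    and sub: "F \<subseteq> \<Gamma>" "G \<subseteq> insert p \<Gamma>" "H \<subseteq> insert q \<Gamma>"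
    and der: "F \<turnstile> Or p q" "G \<turnstile> r" "H \<turnstile> r" by blast
  let ?F = "F \<union> (G - {p}) \<union> (H - {q})"
  have "?F \<turnstile> Or p q" "insert p ?F \<turnstile> r" "insert q ?F \<turnstile> r"
    by (rule deriv_weaken[OF der(1)] deriv_weaken[OF der(2)] deriv_weaken[OF der(3)]; blast)+
  then have "?F \<turnstile> r" by (rule deriv.OrE)
  moreover have "finite ?F" "?F \<subseteq> \<Gamma>" using fin sub by auto
  ultimately show ?case by (intro exI[of _ ?F] conjI)
next
  case (ImpI p \<Gamma> q)
  then obtain F where F: "finite F" "F \<subseteq> insert p \<Gamma>" "F \<turnstile> q" by blast
  have "F - {p} \<turnstile> Imp p q" by (intro deriv.ImpI deriv_weaken[OF F(3)]) blast
  with F show ?case by (intro exI[of _ "F - {p}"]) auto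
next
  case (ImpE \<Gamma> p q)
  then obtain F G where "finite F" "F \<subseteq> \<Gamma>" "F \<turnstile> Imp p q" "finite G" "G \<subseteq> \<Gamma>" "G \<turnstile> p" by blast
  then have "F \<union> G \<turnstile> Imp p q" "F \<union> G \<turnstile> p" "finite (F \<union> G)" "F \<union> G \<subseteq> \<Gamma>"
    by (auto elim: deriv_weaken)
  then show ?case by (intro exI[of _ "F \<union> G"] conjI deriv.ImpE[of _ p q])
qed

text \<open>
  A maximal set among those that do not derive \<open>q\<close> is prime: a formula outside it derives \<open>q\<close>
  together with it, so if a disjunction were in it but neither disjunct, it would derive \<open>q\<close> by
  \<open>OrE\<close>.
\<close>

lemma prime_theory_extension:
  assumes "\<not> \<Gamma> \<turnstile> q"
  obtains T where "prime_theory T" "\<Gamma> \<subseteq> T" "q \<notin> T"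
proof -
  define \<A> where "\<A> = {S. \<Gamma> \<subseteq> S \<and> \<not> S \<turnstile> q}"
  have "\<exists>M\<in>\<A>. \<forall>X\<in>\<A>. M \<subseteq> X \<longrightarrow> X = M"
  proof (rule subset_Zorn_nonempty)
    show "\<A> \<noteq> {}" using assms by (auto simp: \<A>_def)
  next
    fix \<C> assume ne: "\<C> \<noteq> {}" and chain: "subset.chain \<A> \<C>"
    then have sub: "\<C> \<subseteq> \<A>" by (simp add: subset.chain_def)
    have "\<not> \<Union>\<C> \<turnstile> q"
    proof
      assume "\<Union>\<C> \<turnstile> q"
      then obtain F where "finite F" "F \<subseteq> \<Union>\<C>" "F \<turnstile> q" using deriv_finite_subset by blast
      moreover from this obtain S where "S \<in> \<C>" "F \<subseteq> S"
        using finite_subset_Union_chain ne chain by metis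
      ultimately show False using sub by (auto simp: \<A>_def dest: deriv_weaken)
    qed
    moreover have "\<Gamma> \<subseteq> \<Union>\<C>" using ne sub by (auto simp: \<A>_def)
    ultimately show "\<Union>\<C> \<in> \<A>" by (simp add: \<A>_def)
  qed
  then obtain T where "T \<in> \<A>" and max: "\<And>X. X \<in> \<A> \<Longrightarrow> T \<subseteq> X \<Longrightarrow> X = T"
    by blast
  then have "\<Gamma> \<subseteq> T" and T: "\<not> T \<turnstile> q" by (simp_all add: \<A>_def)
  have out: "insert p T \<turnstile> q" if "p \<notin> T" for p
    using max[of "insert p T"] that \<open>\<Gamma> \<subseteq> T\<close> unfolding \<A>_def by blast
  have closed: "p \<in> T" if "T \<turnstile> p" for p
    using deriv_cut[OF that] out T by blast
  have "prime_theory T"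
    unfolding prime_theory_def
  proof (intro conjI allI impI)
    show "Bot \<notin> T" using BotE[OF Assm] T by blast
    show "p \<in> T \<or> r \<in> T" if "Or p r \<in> T" for p r
      using OrE[OF Assm[OF that] out out] T by blast
  qed (rule closed)
  moreover have "q \<notin> T" using T by (auto intro: Assm)
  ultimately show ?thesis using that \<open>\<Gamma> \<subseteq> T\<close> by blast
qed

lemma prime_theory_Bot: "prime_theory T \<Longrightarrow> Bot \<notin> T"
  by (simp add: prime_theory_def)

lemma prime_theory_iff: "prime_theory T \<Longrightarrow> T \<turnstile> p \<longleftrightarrow> p \<in> T"
  using Assm[of p T] by (auto simp: prime_theory_def)

lemma prime_theory_And: "prime_theory T \<Longrightarrow> And p q \<in> T \<longleftrightarrow> p \<in> T \<and> q \<in> T"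
  using deriv_And_iff[of T p q] by (simp add: prime_theory_iff)

lemma prime_theory_Or: "prime_theory T \<Longrightarrow> Or p q \<in> T \<longleftrightarrow> p \<in> T \<or> q \<in> T"
proof
  show "p \<in> T \<or> q \<in> T" if "prime_theory T" "Or p q \<in> T"
    using that by (simp add: prime_theory_def)
  show "Or p q \<in> T" if "prime_theory T" "p \<in> T \<or> q \<in> T"
    using that OrI1[of T p q] OrI2[of T q p] by (auto simp: prime_theory_iff)
qed

lemma prime_theory_Imp:
  assumes "prime_theory T"
  shows "Imp p q \<in> T \<longleftrightarrow> (\<forall>S. prime_theory S \<and> T \<subseteq> S \<and> p \<in> S \<longrightarrow> q \<in> S)"
proof
  assume "Imp p q \<in> T"
  then show "\<forall>S. prime_theory S \<and> T \<subseteq> S \<and> p \<in> S \<longrightarrow> q \<in> S"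
    by (metis ImpE prime_theory_iff subsetD)
next
  assume R: "\<forall>S. prime_theory S \<and> T \<subseteq> S \<and> p \<in> S \<longrightarrow> q \<in> S"
  have "insert p T \<turnstile> q"
  proof (rule ccontr)
    assume "\<not> insert p T \<turnstile> q"
    then obtain S where "prime_theory S" "insert p T \<subseteq> S" "q \<notin> S"
      by (rule prime_theory_extension)
    with R show False by blast
  qed
  then show "Imp p q \<in> T" using prime_theory_iff[OF assms, of "Imp p q"] by (simp add: deriv_Imp_iff)
qed

section \<open>Kripke models\<close>

locale kripke =
  fixes W :: "'w set" and le :: "'w \<Rightarrow> 'w \<Rightarrow> bool" and val :: "'w \<Rightarrow> 'v \<Rightarrow> bool"
  assumes le_refl: "le w w"
    and le_trans: "le u v \<Longrightarrow> le v w \<Longrightarrow> le u w"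
    and val_mono: "le u v \<Longrightarrow> val u a \<Longrightarrow> val v a"
begin

primrec forces :: "'w \<Rightarrow> 'v form \<Rightarrow> bool" where
  "forces w (Var a) \<longleftrightarrow> val w a"
| "forces w Bot \<longleftrightarrow> False"
| "forces w (And p q) \<longleftrightarrow> forces w p \<and> forces w q"
| "forces w (Or p q) \<longleftrightarrow> forces w p \<or> forces w q"
| "forces w (Imp p q) \<longleftrightarrow> (\<forall>u\<in>W. le w u \<longrightarrow> forces u p \<longrightarrow> forces u q)"

lemma forces_mono: "le u w \<Longrightarrow> forces u p \<Longrightarrow> forces w p"
proof (induction p)
  case (Imp p q)
  then show ?case using le_trans by auto
qed (auto dest: val_mono)

lemma soundness:
  assumes "\<Gamma> \<turnstile> p" "w \<in> W" "\<And>q. q \<in> \<Gamma> \<Longrightarrow> forces w q"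
  shows "forces w p"
  using assms
proof (induction arbitrary: w rule: deriv.induct)
  case (OrE \<Gamma> p q r)
  then show ?case by (metis forces.simps(4) insert_iff)
next
  case (ImpI p \<Gamma> q)
  then show ?case by (auto dest: forces_mono)
next
  case (ImpE \<Gamma> p q)
  then show ?case by (metis forces.simps(5) le_refl)
qed auto

end

section \<open>The translation into two variables\<close>

abbreviation (input) x :: "2 form" where "x \<equiv> Var 1"
abbreviation (input) y :: "2 form" where "y \<equiv> Var 0"
abbreviation (input) Neg :: "'v form \<Rightarrow> 'v form" where "Neg p \<equiv> Imp p Bot"

text \<open>The formulas whose truth sets in the ladder are its finite initial segments.\<close>

fun segment :: "nat \<Rightarrow> 2 form" where
  "segment 0 = Bot"
| "segment (Suc 0) = x"
| "segment (Suc (Suc n)) = Or (segment (Suc n)) (Imp (segment (Suc n)) (segment n))"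

definition base :: "2 form" where
  "base = Or (Neg y) (Neg (Neg y))"

text \<open>
  Where \<open>y\<close> fails, the premise and the failure of \<open>segment i\<close> together single out foot \<open>i\<close>: on the
  ladder, the premise holds at the rungs that do not see rung \<open>i\<close>, of which rung \<open>i + 1\<close> is the only
  one outside segment \<open>i\<close>, and foot \<open>i\<close> forces the same segments and the same premise as that rung.
\<close>

definition gen :: "nat \<Rightarrow> 2 form" where
  "gen i = Imp (Imp (segment (Suc i)) (segment i)) (Or y (segment i))"

primrec translate :: "nat form \<Rightarrow> 2 form" where
  "translate (Var i) = Or (gen i) base"
| "translate Bot = base"
| "translate (And p q) = And (translate p) (translate q)"
| "translate (Or p q) = Or (translate p) (translate q)"
| "translate (Imp p q) = Imp (translate p) (translate q)"

lemma base_deriv_translate: "base \<in> \<Gamma> \<Longrightarrow> \<Gamma> \<turnstile> translate p"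
  by (induction p arbitrary: \<Gamma>) (auto intro: Assm AndI OrI1 OrI2 ImpI)

text \<open>
  Only \<open>BotE\<close> needs a reason, since \<open>Bot\<close> is not translated to \<open>Bot\<close>: it survives because all
  translated formulas lie above \<open>base\<close>.
\<close>

lemma translate_deriv: "\<Gamma> \<turnstile> p \<Longrightarrow> translate ` \<Gamma> \<turnstile> translate p"
proof (induction rule: deriv.induct)
  case (BotE \<Gamma> p)
  have "insert base (translate ` \<Gamma>) \<turnstile> translate p" by (rule base_deriv_translate) simp
  with BotE show ?case using deriv_cut by auto
next
  case (OrE \<Gamma> p q r)
  then show ?case by (auto intro: deriv.OrE[of _ "translate p" "translate q"])
qed (auto intro: Assm AndI OrI1 OrI2 ImpI dest: AndE1 AndE2 ImpE)

section \<open>The countermodel\<close>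

datatype world = Prime "nat form set" | Rung nat | Foot nat | Side

definition worlds :: "world set" where
  "worlds = {w. \<forall>T. w = Prime T \<longrightarrow> prime_theory T}"

text \<open>
  Rung \<open>n\<close> lies strictly below the rungs \<open>0, \<dots>, n - 2\<close>. Foot \<open>i\<close> sees what rung \<open>i + 1\<close> sees; the
  shift by one keeps it away from rung \<open>0\<close>, the only one where \<open>x\<close> holds. Every prime
  theory sees the whole ladder, so it forces no segment, and it sees \<open>Side\<close>, where \<open>\<not>y\<close> holds,
  so it does not force \<open>base\<close>.
\<close>

fun below :: "world \<Rightarrow> world \<Rightarrow> bool" where
  "below (Prime S) (Prime T) \<longleftrightarrow> S \<subseteq> T"
| "below (Prime S) (Foot i) \<longleftrightarrow> Var i \<notin> S"
| "below (Prime S) _ \<longleftrightarrow> True"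
| "below (Rung n) (Rung m) \<longleftrightarrow> m = n \<or> Suc m < n"
| "below (Foot i) (Rung m) \<longleftrightarrow> m = Suc i \<or> m < i"
| "below (Foot i) (Foot j) \<longleftrightarrow> i = j"
| "below Side Side \<longleftrightarrow> True"
| "below _ _ \<longleftrightarrow> False"

definition truth :: "world \<Rightarrow> 2 \<Rightarrow> bool" where
  "truth w a \<longleftrightarrow> (if a = 0 then \<exists>n. w = Rung n else w = Rung 0 \<or> w = Side)"

interpretation kripke worlds below truth
proof
  show "below w w" for w by (cases w) auto
  show "below u w" if "below u v" "below v w" for u v w
    using that by (cases u; cases v; cases w) auto
  show "truth v a" if "below u v" "truth u a" for u v a
    using that by (cases u; cases v) (auto simp: truth_def split: if_splits)
qed

lemma worlds_simps [simp]:
  "Prime T \<in> worlds \<longleftrightarrow> prime_theory T" "Rung n \<in> worlds" "Foot i \<in> worlds" "Side \<in> worlds"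
  by (auto simp: worlds_def)

lemma truth_simps [simp]:
  "truth w 0 \<longleftrightarrow> (\<exists>n. w = Rung n)" "truth w 1 \<longleftrightarrow> w = Rung 0 \<or> w = Side"
  by (auto simp: truth_def)

lemma ball_worlds:
  "(\<forall>w\<in>worlds. P w) \<longleftrightarrow>
     (\<forall>T. prime_theory T \<longrightarrow> P (Prime T)) \<and> (\<forall>n. P (Rung n)) \<and> (\<forall>i. P (Foot i)) \<and> P Side"
proof -
  have "(\<forall>w. w \<in> worlds \<longrightarrow> P w) \<longleftrightarrow>
     (\<forall>T. Prime T \<in> worlds \<longrightarrow> P (Prime T)) \<and> (\<forall>n. P (Rung n)) \<and> (\<forall>i. P (Foot i)) \<and> P Side"
    by (metis world.exhaust worlds_simps(2-4))
  then show ?thesis by (simp add: Ball_def)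
qed

text \<open>
  With these equations, simplification finds that \<open>Imp (segment (Suc n)) (segment n)\<close> holds at the
  points of the ladder that do not see rung \<open>n\<close>; together with segment \<open>n + 1\<close>, these rungs make up
  segment \<open>n + 2\<close>.
\<close>

lemma less_step:
  "(k < Suc n \<longrightarrow> k < n) \<longleftrightarrow> k \<noteq> n" "(k < n \<longrightarrow> Suc k < n) \<longleftrightarrow> Suc k \<noteq> n"
  by auto

lemma Rung_segment: "forces (Rung m) (segment n) \<longleftrightarrow> m < n"
proof (induction n arbitrary: m rule: segment.induct)
  case (3 n)
  have "forces (Rung m) (Imp (segment (Suc n)) (segment n)) \<longleftrightarrow> m \<noteq> n \<and> \<not> Suc n < m"
    by (simp add: ball_worlds 3 less_step) blast
  then show ?case by (auto simp: 3)
qed auto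

lemma Foot_segment: "forces (Foot i) (segment n) \<longleftrightarrow> Suc i < n"
proof (induction n rule: segment.induct)
  case (3 n)
  have "forces (Foot i) (Imp (segment (Suc n)) (segment n)) \<longleftrightarrow> Suc i \<noteq> n \<and> \<not> n < i"
    by (simp add: ball_worlds 3 Rung_segment less_step) blast
  then show ?case by (auto simp: 3)
qed auto

lemma Side_segment: "forces Side (segment n) \<longleftrightarrow> n \<noteq> 0"
  by (induction n rule: segment.induct) auto

lemma gadget_forces_base:
  "forces (Rung n) base" "forces (Foot i) base" "forces Side base"
  by (auto simp: base_def ball_worlds)

lemma Prime_forces_base: "\<not> forces (Prime T) base"
  by (auto simp: base_def ball_worlds)

text \<open>
  The premise of \<open>gen i\<close> is arranged to fail at every prime theory, because rung \<open>i\<close> is visible from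
  there. So \<open>gen i\<close> can only be refuted in the gadget, and there only at foot \<open>i\<close>.
\<close>

lemma Prime_forces_gen: "forces (Prime T) (gen i) \<longleftrightarrow> Var i \<in> T"
proof -
  define P where "P = Imp (segment (Suc i)) (segment i)"
  have "\<not> forces (Prime S) P" for S
    using forces_mono[of "Prime S" "Rung i" P] by (auto simp: P_def ball_worlds Rung_segment)
  moreover have "(forces (Foot j) P \<longrightarrow> forces (Foot j) (segment i)) \<longleftrightarrow> j \<noteq> i" for j
  proof -
    have "forces (Foot j) P \<longleftrightarrow> Suc j \<noteq> i \<and> \<not> i < j"
      by (simp add: P_def ball_worlds Rung_segment Foot_segment less_step) blast
    then show ?thesis by (auto simp: Foot_segment)
  qed
  moreover have "forces Side P \<longrightarrow> forces Side (segment i)"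
    by (simp add: P_def ball_worlds Side_segment)
  moreover have "gen i = Imp P (Or y (segment i))" by (simp add: gen_def P_def)
  ultimately show ?thesis by (auto simp: ball_worlds)
qed

lemma gadget_forces_translate:
  "forces (Rung n) (translate p)" "forces (Foot i) (translate p)" "forces Side (translate p)"
  using base_deriv_translate[of "{base}" p] gadget_forces_base
  by (auto intro: soundness)

text \<open>
  Above a prime theory, only prime theories need be considered for an implication, since all
  other worlds force all translated formulas; the induction is thus the one for the truth lemma of
  the canonical model.
\<close>

lemma forces_translate_iff: "prime_theory T \<Longrightarrow> forces (Prime T) (translate p) \<longleftrightarrow> p \<in> T"
proof (induction p arbitrary: T)
  case (Var i)
  then show ?case by (simp add: Prime_forces_gen Prime_forces_base)
next
  case Bot
  then show ?case by (simp add: Prime_forces_base prime_theory_Bot)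
next
  case (And p q)
  then show ?case by (simp add: prime_theory_And)
next
  case (Or p q)
  then show ?case by (simp add: prime_theory_Or)
next
  case (Imp p q)
  then show ?case by (auto simp: ball_worlds gadget_forces_translate prime_theory_Imp)
qed

lemma translate_deriv_iff: "{translate p} \<turnstile> translate q \<longleftrightarrow> {p} \<turnstile> q"
proof
  assume tr: "{translate p} \<turnstile> translate q"
  show "{p} \<turnstile> q"
  proof (rule ccontr)
    assume "\<not> {p} \<turnstile> q"
    then obtain T where T: "prime_theory T" "{p} \<subseteq> T" "q \<notin> T"
      by (rule prime_theory_extension)
    then have "forces (Prime T) (translate p)" by (simp add: forces_translate_iff)
    then have "forces (Prime T) (translate q)" using soundness[OF tr, of "Prime T"] T by simp
    with T show False by (simp add: forces_translate_iff)
  qed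
next
  assume "{p} \<turnstile> q"
  from translate_deriv[OF this] show "{translate p} \<turnstile> translate q" by simp
qed

section \<open>The embedding\<close>

lift_definition embedding :: "H_omega \<Rightarrow> H_2" is translate
  by (simp add: int_equiv_iff translate_deriv_iff)

theorem theorem14:
  shows "\<exists>f :: H_omega \<Rightarrow> H_2. lattice_embedding f"
proof -
  have "p = q" if "embedding p = embedding q" for p q
    using that by transfer (simp add: int_equiv_iff translate_deriv_iff)
  moreover have "embedding (inf p q) = inf (embedding p) (embedding q)" for p q
    by transfer (simp add: int_equiv_iff Assm)
  moreover have "embedding (sup p q) = sup (embedding p) (embedding q)" for p q
    by transfer (simp add: int_equiv_iff Assm)
  ultimately have "lattice_embedding embedding"
    by (simp add: lattice_embedding_def inj_def)
  then show ?thesis by blast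
qed

end
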